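(* Let $\mathcal{H}$ be a real Hilbert space, let $f \in \Gamma_0(\mathcal{H})$, let $\gamma \in \left]0,+\infty\right[$, and let $(x,\eta) \in \mathcal{H} \times \mathbb{R}$. Let $\widetilde{f}$ be the perspective of $f$, and write $P = P_{\overline{\operatorname{dom}}\, f^*}$ for the projection operator onto the closure $\overline{\operatorname{dom}}\, f^*$ of $\operatorname{dom} f^*$. Then the following hold: (i) Suppose that $\eta + \gamma f^*\big(P(x/\gamma)\big) \leq 0$. Then $$\operatorname{prox}_{\gamma \widetilde{f}}(x,\eta) = \left(x - \gamma P\left(\frac{x}{\gamma}\right),\, 0\right).$$ (ii) Suppose that $\eta + \gamma f^*\big(P(x/\gamma)\big) > 0$ (the value $+\infty$ being allowed). Then there exists a unique real number $\mu$ with $0 < \mu \leq \eta + \gamma f^*\big(P(x/\gamma)\big)$ such that $$\mu = \eta + \gamma f^*\left(\operatorname{prox}_{\frac{\mu}{\gamma} f^*}\left(\frac{x}{\gamma}\right)\right).$$ Furthermore, for this $\mu$, $$\operatorname{prox}_{\gamma \widetilde{f}}(x,\eta) = \left(x - \gamma \operatorname{prox}_{\frac{\mu}{\gamma} f^*}\left(\frac{x}{\gamma}\right),\, \mu\right).$$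
   Context: $\Gamma_0(\mathcal{H})$ is the class of proper lower semicontinuous convex functions from $\mathcal{H}$ to $\left]-\infty,+\infty\right]$, where $f$ is proper if $\operatorname{dom} f = \{x \in \mathcal{H} : f(x) < +\infty\}$ is nonempty. $\mathcal{H} \oplus \mathbb{R}$ denotes the Hilbert direct sum, i.e. $\mathcal{H}\times\mathbb{R}$ with inner product $\langle (x,\eta) \mid (y,\nu)\rangle = \langle x \mid y\rangle + \eta\nu$. The Fenchel conjugate of $f$ is $f^*: u \mapsto \sup_{x \in \mathcal{H}} (\langle x \mid u\rangle - f(x))$; one has $f^* \in \Gamma_0(\mathcal{H})$. The recession function of $f$ is $(\operatorname{rec} f)(x) = \lim_{t \to +\infty} \frac{f(x_0 + t x) - f(x_0)}{t}$, for any $x_0 \in \operatorname{dom} f$ (the value does not depend on $x_0$). The perspective of $f$ is the function $\widetilde{f}: \mathcal{H} \times \mathbb{R} \to \left]-\infty,+\infty\right]$ given by $\widetilde{f}(x,\eta) = \eta f(x/\eta)$ if $\eta > 0$, $\widetilde{f}(x,0) = (\operatorname{rec} f)(x)$, and $\widetilde{f}(x,\eta) = +\infty$ if $\eta < 0$. One has $\widetilde{f} \in \Gamma_0(\mathcal{H} \oplus \mathbb{R})$. For a real Hilbert space $\mathcal{K}$ and $g \in \Gamma_0(\mathcal{K})$, the proximity operator of $g$ is $\operatorname{prox}_g: \mathcal{K} \to \mathcal{K}$, where $\operatorname{prox}_g x$ is the unique minimizer over $y \in \mathcal{K}$ of $g(y) + \frac{1}{2}\|x-y\|^2$. For a nonempty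 closed convex set $C$, $P_C$ is the projection operator onto $C$ (nearest point). The proximity operator of $\gamma\widetilde{f}$ is taken in $\mathcal{H} \oplus \mathbb{R}$. *)

theory Defs
  imports "HOL-Analysis.Analysis"
begin

text \<open>
  A real Hilbert space is a type of class \<open>{real_inner, complete_space}\<close>. The product type
  \<open>'a \<times> real\<close> carries the inner product of the Hilbert direct sum.
  Functions with values in \<open>]-\<infinity>, +\<infinity>]\<close> are functions into \<^typ>\<open>ereal\<close> that avoid \<open>-\<infinity>\<close>;
  this is part of \<open>proper_fun\<close>.
\<close>

definition edom :: "('a \<Rightarrow> ereal) \<Rightarrow> 'a set" where
  "edom f = {x. f x < \<infinity>}"

definition proper_fun :: "('a \<Rightarrow> ereal) \<Rightarrow> bool" where
  "proper_fun f \<longleftrightarrow> (\<forall>x. f x \<noteq> -\<infinity>) \<and> edom f \<noteq> {}"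

definition lsc :: "('a::topological_space \<Rightarrow> ereal) \<Rightarrow> bool" where
  "lsc f \<longleftrightarrow> (\<forall>x. f x \<le> Liminf (at x) f)"

text \<open>
  The weight \<open>t\<close> ranges over the open interval; for proper functions the right-hand side then
  never has the form \<open>\<infinity> + -\<infinity>\<close> or \<open>0 * \<infinity>\<close>.
\<close>

definition econvex :: "('a::real_vector \<Rightarrow> ereal) \<Rightarrow> bool" where
  "econvex f \<longleftrightarrow> (\<forall>x y. \<forall>t::real. 0 < t \<and> t < 1 \<longrightarrow>
     f ((1 - t) *\<^sub>R x + t *\<^sub>R y) \<le> ereal (1 - t) * f x + ereal t * f y)"

definition Gamma0 :: "('a::{real_inner,complete_space} \<Rightarrow> ereal) set" where
  "Gamma0 = {f. proper_fun f \<and> lsc f \<and> econvex f}"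

definition fenchel_conj :: "('a::real_inner \<Rightarrow> ereal) \<Rightarrow> 'a \<Rightarrow> ereal" where
  "fenchel_conj f u = (SUP x. ereal (inner x u) - f x)"

text \<open>
  The common value of the limits over all base points \<open>x0\<close> in the domain; for members of
  \<open>Gamma0\<close> it exists and is unique.
\<close>

definition rec_fun :: "('a::real_inner \<Rightarrow> ereal) \<Rightarrow> 'a \<Rightarrow> ereal" where
  "rec_fun f x = (THE r. \<forall>x0\<in>edom f.
     ((\<lambda>t::real. (f (x0 + t *\<^sub>R x) - f x0) / ereal t) \<longlongrightarrow> r) at_top)"

definition perspective :: "('a::real_inner \<Rightarrow> ereal) \<Rightarrow> 'a \<times> real \<Rightarrow> ereal" where
  "perspective f = (\<lambda>(x, \<eta>).
     if \<eta> > 0 then ereal \<eta> * f (x /\<^sub>R \<eta>)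
     else if \<eta> = 0 then rec_fun f x
     else \<infinity>)"

definition prox :: "('a::{real_inner,complete_space} \<Rightarrow> ereal) \<Rightarrow> 'a \<Rightarrow> 'a" where
  "prox g x = (THE p. is_arg_min (\<lambda>y. g y + ereal ((norm (x - y))\<^sup>2 / 2)) (\<lambda>y. True) p)"

text \<open>
  The library's \<open>closest_point\<close> requires \<open>heine_borel\<close>, hence finite dimension.
\<close>

definition proj_onto :: "'a::{real_inner,complete_space} set \<Rightarrow> 'a \<Rightarrow> 'a" where
  "proj_onto C x = (THE p. p \<in> C \<and> (\<forall>y\<in>C. dist x p \<le> dist x y))"

end

theory Submission
  imports Defs
begin

text \<open>
  The perspective of \<open>f\<close> is the support function of \<open>C = {(u, \<nu>). f\<^sup>* u + \<nu> \<le> 0}\<close>, so by Moreau's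
  decomposition \<open>prox\<close> of its multiple by \<open>\<gamma>\<close> maps \<open>z\<close> to \<open>z - \<gamma> w\<close>, where \<open>w\<close> is the projection of
  \<open>z / \<gamma>\<close> onto \<open>C\<close>. Whether the residual \<open>\<mu>\<close> in the last coordinate vanishes decides between the
  two cases; for \<open>\<mu> > 0\<close> the normal cone condition at \<open>w\<close> says that the first component of \<open>w\<close> is
  the \<open>prox\<close> of \<open>(\<mu> / \<gamma>) f\<^sup>*\<close>. This gives existence of \<open>\<mu>\<close>, and its uniqueness is that of the
  last coordinate of \<open>prox\<close>.
\<close>

section \<open>Variational inequalities for projections and proximity operators\<close>

lemma power2_norm_diff_convex_comb:
  fixes x p y :: "'a::real_inner"
  shows "(norm (x - ((1 - t) *\<^sub>R p + t *\<^sub>R y)))\<^sup>2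
    = (norm (x - p))\<^sup>2 - 2 * t * inner (x - p) (y - p) + t\<^sup>2 * (norm (y - p))\<^sup>2"
  unfolding power2_norm_eq_inner
  by (simp add: inner_diff_left inner_diff_right inner_add_left inner_add_right inner_commute
      power2_eq_square algebra_simps)

text \<open>Parallelogram identity; its negative term forces minimizing sequences to be
  Cauchy.\<close>

lemma power2_norm_diff_midpoint:
  fixes x y z :: "'a::real_inner"
  shows "(norm (x - ((1/2) *\<^sub>R y + (1/2) *\<^sub>R z)))\<^sup>2
    = (norm (x - y))\<^sup>2 / 2 + (norm (x - z))\<^sup>2 / 2 - (norm (y - z))\<^sup>2 / 4"
  unfolding power2_norm_eq_inner
  by (simp add: inner_diff_left inner_diff_right inner_add_left inner_add_right inner_commute
      field_simps)

text \<open>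
  With \<open>E\<close> an epigraph, the conclusion is the variational characterization of its \<open>prox\<close>; with
  \<open>E = C \<times> {0..}\<close> it is that of the projection onto \<open>C\<close>.
\<close>

lemma closed_convex_prox_exists:
  fixes E :: "('a::{real_inner,complete_space} \<times> real) set"
  assumes "closed E" "convex E" "E \<noteq> {}"
    and minorant: "\<And>y s. (y, s) \<in> E \<Longrightarrow> inner a y + c \<le> s"
  obtains p r where "(p, r) \<in> E" "\<And>y s. (y, s) \<in> E \<Longrightarrow> r + inner (x - p) (y - p) \<le> s"
proof -
  \<comment> \<open>The objective of \<open>prox\<close> with the function value replaced by a real
    height, so that the minimization over \<open>E\<close> is real-valued.\<close>
  define \<phi> where "\<phi> z = snd z + (norm (x - fst z))\<^sup>2 / 2" for z :: "'a \<times> real"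
  have bound: "inner a x + c - (norm a)\<^sup>2 / 2 \<le> \<phi> z" if "z \<in> E" for z
  proof -
    have "inner a (fst z) + c \<le> snd z"
      using minorant[of "fst z" "snd z"] that by simp
    moreover have "0 \<le> (norm (a - (x - fst z)))\<^sup>2" by simp
    ultimately show ?thesis
      unfolding \<phi>_def power2_norm_eq_inner
      by (simp add: inner_diff_left inner_diff_right inner_add_left inner_add_right inner_commute
          field_simps)
  qed
  define m where "m = Inf (\<phi> ` E)"
  have bdd: "bdd_below (\<phi> ` E)" using bound by (auto intro!: bdd_belowI)
  have m_le: "m \<le> \<phi> z" if "z \<in> E" for z
    unfolding m_def using bdd that by (auto intro: cInf_lower)
  have "\<exists>z\<in>E. \<phi> z < m + 1 / real (Suc n)" for n
  proof -
    have "Inf (\<phi> ` E) < m + 1 / real (Suc n)" unfolding m_def by simp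
    then show ?thesis using cInf_lessD[of "\<phi> ` E"] \<open>E \<noteq> {}\<close> by auto
  qed
  then obtain z where zE: "\<And>n. z n \<in> E" and z_less: "\<And>n. \<phi> (z n) < m + 1 / real (Suc n)"
    by metis
  \<comment> \<open>The midpoint of two points of \<open>E\<close> has objective at least
    \<open>m\<close>, so near-minimizers have close first components.\<close>
  have dist_bound: "(norm (fst z1 - fst z2))\<^sup>2 \<le> 4 * ((\<phi> z1 - m) + (\<phi> z2 - m))"
    if "z1 \<in> E" "z2 \<in> E" for z1 z2
  proof -
    have "(1/2) *\<^sub>R z1 + (1/2) *\<^sub>R z2 \<in> E"
      using that \<open>convex E\<close> by (auto intro!: convexD)
    from m_le[OF this] show ?thesis
      unfolding \<phi>_def fst_add snd_add fst_scaleR snd_scaleR power2_norm_diff_midpoint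
      by (simp add: field_simps)
  qed
  have "Cauchy (\<lambda>n. fst (z n))"
  proof (rule metric_CauchyI)
    fix e :: real assume "0 < e"
    \<comment> \<open>Two gaps below an eighth of \<open>e\<^sup>2\<close>, summed and multiplied by
      4, stay below \<open>e\<^sup>2\<close>.\<close>
    then obtain N where N: "1 / real (Suc N) < e\<^sup>2 / 8"
      using nat_approx_posE[of "e\<^sup>2 / 8"] by auto
    show "\<exists>M. \<forall>i\<ge>M. \<forall>n\<ge>M. dist (fst (z i)) (fst (z n)) < e"
    proof (intro exI allI impI)
      fix i n assume "N \<le> i" "N \<le> n"
      then have "1 / real (Suc i) \<le> 1 / real (Suc N)" "1 / real (Suc n) \<le> 1 / real (Suc N)"
        by (auto intro!: divide_left_mono)
      then have "\<phi> (z i) - m < e\<^sup>2 / 8" "\<phi> (z n) - m < e\<^sup>2 / 8"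
        using z_less[of i] z_less[of n] N by linarith+
      with dist_bound[OF zE zE, of i n]
      have "(norm (fst (z i) - fst (z n)))\<^sup>2 < e\<^sup>2" by simp
      then show "dist (fst (z i)) (fst (z n)) < e"
        using \<open>0 < e\<close> power2_less_imp_less by (fastforce simp: dist_norm)
    qed
  qed
  then obtain p where p: "(\<lambda>n. fst (z n)) \<longlonglongrightarrow> p"
    using Cauchy_convergent convergentD by blast
  have "(\<lambda>n. \<phi> (z n)) \<longlonglongrightarrow> m"
  proof (rule tendsto_sandwich)
    show "\<forall>\<^sub>F n in sequentially. m \<le> \<phi> (z n)" using m_le zE by simp
    show "\<forall>\<^sub>F n in sequentially. \<phi> (z n) \<le> m + 1 / real (Suc n)"
      using z_less by (intro always_eventually) (auto intro: less_imp_le)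
    show "(\<lambda>n. m + 1 / real (Suc n)) \<longlonglongrightarrow> m"
      using tendsto_add[OF tendsto_const LIMSEQ_inverse_real_of_nat, of m]
      by (simp add: inverse_eq_divide)
  qed simp
  \<comment> \<open>Convergence of the heights follows by subtracting the quadratic term from the
    objective.\<close>
  then have "(\<lambda>n. \<phi> (z n) - (norm (x - fst (z n)))\<^sup>2 / 2) \<longlonglongrightarrow> m - (norm (x - p))\<^sup>2 / 2"
    using p by (intro tendsto_intros) auto
  then have snd_lim: "(\<lambda>n. snd (z n)) \<longlonglongrightarrow> m - (norm (x - p))\<^sup>2 / 2"
    by (simp add: \<phi>_def)
  define r where "r = m - (norm (x - p))\<^sup>2 / 2"
  have "z \<longlonglongrightarrow> (p, r)"
    using tendsto_Pair[OF p snd_lim] by (simp add: r_def)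
  then have prE: "(p, r) \<in> E"
    using closed_sequentially[OF \<open>closed E\<close>] zE by blast
  have "r + inner (x - p) (y - p) \<le> s" if ys: "(y, s) \<in> E" for y s
  proof -
    \<comment> \<open>Minimality is tested on the segment from \<open>(p, r)\<close> to
      \<open>(y, s)\<close>; after division by \<open>t\<close> the quadratic term vanishes as
      \<open>t\<close> tends to 0.\<close>
    have est: "inner (x - p) (y - p) - (s - r) \<le> t / 2 * (norm (y - p))\<^sup>2"
      if t: "0 < t" "t < 1" for t
    proof -
      have "(1 - t) *\<^sub>R (p, r) + t *\<^sub>R (y, s) \<in> E"
        using prE ys t \<open>convex E\<close> by (intro convexD) auto
      from m_le[OF this]
      have "m \<le> (1 - t) * r + t * s + (norm (x - ((1 - t) *\<^sub>R p + t *\<^sub>R y)))\<^sup>2 / 2"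
        by (simp add: \<phi>_def)
      then have "t * (inner (x - p) (y - p) - (s - r)) \<le> t * (t / 2 * (norm (y - p))\<^sup>2)"
        unfolding power2_norm_diff_convex_comb by (simp add: r_def field_simps power2_eq_square)
      then show ?thesis using t by simp
    qed
    have "inner (x - p) (y - p) - (s - r) \<le> 0"
    proof (rule tendsto_lowerbound)
      show "((\<lambda>t. t / 2 * (norm (y - p))\<^sup>2) \<longlongrightarrow> 0) (at_right (0::real))"
        by (auto intro!: tendsto_eq_intros)
      show "\<forall>\<^sub>F t in at_right (0::real). inner (x - p) (y - p) - (s - r) \<le> t / 2 * (norm (y - p))\<^sup>2"
        using est by (auto simp: eventually_at_right_field intro!: exI[of _ 1])
    qed simp
    then show ?thesis by simp
  qed
  with prE that show ?thesis by blast
qed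

text \<open>Expanding the squared distance about \<open>p\<close> leaves a cross term of favourable
  sign: any other point of \<open>C\<close> is strictly farther, as the definite description
  requires.\<close>

lemma proj_ontoI:
  assumes "p \<in> C" and le: "\<And>y. y \<in> C \<Longrightarrow> inner (x - p) (y - p) \<le> 0"
  shows "proj_onto C x = p"
proof -
  have eq: "(dist x y)\<^sup>2 = (dist x p)\<^sup>2 - 2 * inner (x - p) (y - p) + (dist p y)\<^sup>2" for y
    unfolding dist_norm power2_norm_eq_inner
    by (simp add: inner_diff_left inner_diff_right inner_commute algebra_simps)
  have "dist x p \<le> dist x y" if "y \<in> C" for y
  proof (rule power2_le_imp_le)
    show "(dist x p)\<^sup>2 \<le> (dist x y)\<^sup>2"
      using eq[of y] le[OF that] zero_le_power2[of "dist p y"] by linarith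
  qed simp
  moreover have "q = p" if "q \<in> C" "\<And>y. y \<in> C \<Longrightarrow> dist x q \<le> dist x y" for q
  proof -
    have "(dist x q)\<^sup>2 \<le> (dist x p)\<^sup>2"
      using that(2)[OF \<open>p \<in> C\<close>] by (simp add: power_mono)
    with eq[of q] le[OF that(1)] have "(dist p q)\<^sup>2 \<le> 0" by linarith
    then show ?thesis by simp
  qed
  ultimately show ?thesis
    unfolding proj_onto_def using \<open>p \<in> C\<close> by (intro the_equality) blast+
qed

lemma closed_convex_proj:
  fixes C :: "'a::{real_inner,complete_space} set"
  assumes "closed C" "convex C" "C \<noteq> {}"
  shows "proj_onto C x \<in> C" "y \<in> C \<Longrightarrow> inner (x - proj_onto C x) (y - proj_onto C x) \<le> 0"
proof -
  obtain p r where p: "(p, r) \<in> C \<times> {0..}"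
    and le: "\<And>y s. (y, s) \<in> C \<times> {0..} \<Longrightarrow> r + inner (x - p) (y - p) \<le> s"
  proof (rule closed_convex_prox_exists[of "C \<times> {0::real..}" 0 0 x])
    show "closed (C \<times> {0::real..})" "convex (C \<times> {0::real..})" "C \<times> {0::real..} \<noteq> {}"
      using assms by (auto intro: closed_Times convex_Times)
  qed auto
  have "inner (x - p) (y - p) \<le> 0" if "y \<in> C" for y
    using le[of y 0] p that by auto
  with p have "p \<in> C" "\<And>y. y \<in> C \<Longrightarrow> inner (x - p) (y - p) \<le> 0" by auto
  with proj_ontoI[of p C x]
  show "proj_onto C x \<in> C" "y \<in> C \<Longrightarrow> inner (x - proj_onto C x) (y - proj_onto C x) \<le> 0"
    by auto
qed

text \<open>The inequality says that \<open>x - p\<close> is a subgradient of \<open>g\<close> at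
  \<open>p\<close>. The objective then grows by at least half the squared distance from
  \<open>p\<close>, which gives minimality and uniqueness.\<close>

lemma proxI:
  assumes gp: "g p = ereal c" and le: "\<And>y. ereal (c + inner (x - p) (y - p)) \<le> g y"
  shows "prox g x = p"
proof -
  have eq: "c + inner (x - p) (y - p) + (norm (x - y))\<^sup>2 / 2
      = c + (norm (x - p))\<^sup>2 / 2 + (norm (p - y))\<^sup>2 / 2" for y
    unfolding power2_norm_eq_inner
    by (simp add: inner_diff_left inner_diff_right inner_commute field_simps)
  have strong: "ereal (c + (norm (x - p))\<^sup>2 / 2 + (norm (p - y))\<^sup>2 / 2)
      \<le> g y + ereal ((norm (x - y))\<^sup>2 / 2)" for y
    using add_right_mono[OF le[of y], of "ereal ((norm (x - y))\<^sup>2 / 2)"] eq[of y] by simp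
  have "is_arg_min (\<lambda>y. g y + ereal ((norm (x - y))\<^sup>2 / 2)) (\<lambda>y. True) p"
    unfolding is_arg_min_linorder
  proof (intro conjI allI impI TrueI)
    fix y
    have "g p + ereal ((norm (x - p))\<^sup>2 / 2)
        \<le> ereal (c + (norm (x - p))\<^sup>2 / 2 + (norm (p - y))\<^sup>2 / 2)"
      by (simp add: gp)
    with strong[of y] show "g p + ereal ((norm (x - p))\<^sup>2 / 2) \<le> g y + ereal ((norm (x - y))\<^sup>2 / 2)"
      by (rule order_trans[rotated])
  qed
  moreover have "q = p" if "is_arg_min (\<lambda>y. g y + ereal ((norm (x - y))\<^sup>2 / 2)) (\<lambda>y. True) q" for q
  proof -
    have "g q + ereal ((norm (x - q))\<^sup>2 / 2) \<le> g p + ereal ((norm (x - p))\<^sup>2 / 2)"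
      using that unfolding is_arg_min_linorder by blast
    with strong[of q] have "ereal (c + (norm (x - p))\<^sup>2 / 2 + (norm (p - q))\<^sup>2 / 2)
        \<le> g p + ereal ((norm (x - p))\<^sup>2 / 2)" by (rule order_trans)
    then have "(norm (p - q))\<^sup>2 \<le> 0" by (simp add: gp)
    then show ?thesis by simp
  qed
  ultimately show ?thesis unfolding prox_def by (intro the_equality)
qed

section \<open>Epigraphs\<close>

text \<open>Heights are real rather than extended, which places the epigraph in
  \<open>'a \<times> real\<close>, where projections are available.\<close>

definition epi :: "('a \<Rightarrow> ereal) \<Rightarrow> ('a \<times> real) set" where
  "epi f = {(y, s). f y \<le> ereal s}"

lemma mem_epi [simp]: "(y, s) \<in> epi f \<longleftrightarrow> f y \<le> ereal s"
  by (simp add: epi_def)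

lemma closed_epi:
  fixes f :: "'a::metric_space \<Rightarrow> ereal"
  assumes "lsc f"
  shows "closed (epi f)"
  unfolding closed_sequential_limits
proof (intro allI impI, elim conjE)
  fix z l assume zE: "\<forall>n. z n \<in> epi f" and lim: "z \<longlonglongrightarrow> l"
  have "f (fst l) \<le> ereal (snd l)"
  proof (rule ccontr)
    assume "\<not> f (fst l) \<le> ereal (snd l)"
    then obtain c where c: "ereal (snd l) < ereal c" "ereal c < f (fst l)"
      using ereal_dense2 by (metis not_le)
    then have "ereal c < Liminf (at (fst l)) f"
      using assms unfolding lsc_def by (meson less_le_trans)
    then have "\<forall>\<^sub>F y in at (fst l). ereal c < f y"
      using less_LiminfD by blast
    \<comment> \<open>\<open>lsc\<close> speaks of punctured neighbourhoods; the strict bound at the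
      point itself fills the gap.\<close>
    then have "\<forall>\<^sub>F y in nhds (fst l). ereal c < f y"
      using c(2) by (auto simp: eventually_at_filter elim: eventually_mono)
    then have "\<forall>\<^sub>F n in sequentially. ereal c < f (fst (z n))"
      using tendsto_fst[OF lim] unfolding filterlim_iff by blast
    moreover have "\<forall>\<^sub>F n in sequentially. snd (z n) < c"
      using tendsto_snd[OF lim] c(1) by (auto intro: order_tendstoD)
    ultimately have "\<forall>\<^sub>F n in sequentially. False"
    proof eventually_elim
      case (elim n)
      have "f (fst (z n)) \<le> ereal (snd (z n))"
        using zE by (metis mem_epi prod.collapse)
      with elim show False by (meson ereal_less(2) less_ereal.simps(1) less_le_trans not_less_iff_gr_or_eq)
    qed
    then show False by simp
  qed
  then show "l \<in> epi f" by (metis mem_epi prod.collapse)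
qed

lemma convex_epi:
  assumes "econvex f"
  shows "convex (epi f)"
proof (rule convexI)
  fix z w and u v :: real
  assume z: "z \<in> epi f" and w: "w \<in> epi f" and uv: "0 \<le> u" "0 \<le> v" "u + v = 1"
  show "u *\<^sub>R z + v *\<^sub>R w \<in> epi f"
  proof (cases "u = 0 \<or> v = 0")
    case True
    with z w uv show ?thesis by auto
  next
    case False
    with uv have v: "0 < v" "v < 1" "u = 1 - v" by auto
    obtain y s y' s' where ys: "z = (y, s)" "w = (y', s')" by fastforce
    have "f ((1 - v) *\<^sub>R y + v *\<^sub>R y') \<le> ereal (1 - v) * f y + ereal v * f y'"
      using assms v unfolding econvex_def by blast
    also have "\<dots> \<le> ereal (1 - v) * ereal s + ereal v * ereal s'"
      using z w ys v by (intro add_mono ereal_mult_left_mono) auto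
    finally show ?thesis by (simp add: ys v)
  qed
qed

section \<open>Fenchel conjugates of proper functions\<close>

text \<open>Testing against real upper bounds \<open>r\<close> of \<open>f y\<close> replaces
  extended subtraction by real inequalities indexed by the epigraph.\<close>

lemma fenchel_conj_le_iff:
  assumes "proper_fun f"
  shows "fenchel_conj f u \<le> ereal s \<longleftrightarrow> (\<forall>y r. f y \<le> ereal r \<longrightarrow> inner y u - r \<le> s)"
proof -
  have "ereal (inner u y) - f y \<le> ereal s \<longleftrightarrow> (\<forall>r. f y \<le> ereal r \<longrightarrow> inner y u - r \<le> s)" for y
  proof (cases "f y")
    case (real v)
    then show ?thesis by (auto simp: inner_commute)
  next
    case MInf
    then show ?thesis using assms by (simp add: proper_fun_def)
  qed auto
  then show ?thesis
    unfolding fenchel_conj_def SUP_le_iff by (auto simp: inner_commute)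
qed

lemma proper_fun_finite_point:
  assumes "proper_fun f"
  obtains y r where "f y = ereal r"
proof -
  obtain y where "f y < \<infinity>" "f y \<noteq> -\<infinity>"
    using assms by (auto simp: proper_fun_def edom_def)
  then show ?thesis using that by (cases "f y") auto
qed

lemma fenchel_young:
  assumes "proper_fun f" "f y \<le> ereal r" "fenchel_conj f u \<le> ereal s"
  shows "inner y u \<le> r + s"
  using assms fenchel_conj_le_iff[OF assms(1)] by force

lemma fenchel_conj_not_MInf:
  assumes "proper_fun f"
  shows "fenchel_conj f u \<noteq> -\<infinity>"
proof
  assume *: "fenchel_conj f u = -\<infinity>"
  obtain y r where "f y = ereal r" using assms by (rule proper_fun_finite_point)
  then show False
    using fenchel_young[OF assms, of y r u "inner y u - r - 1"] * by simp
qed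

text \<open>As an intersection of closed half-spaces the set is visibly closed and convex.\<close>

lemma epi_fenchel_conj:
  assumes "proper_fun f"
  shows "epi (fenchel_conj f) = (\<Inter>(y, r)\<in>epi f. {z. inner (y, -1) z \<le> r})"
  by (fastforce simp: fenchel_conj_le_iff[OF assms] algebra_simps)

lemma closed_epi_fenchel_conj: "proper_fun f \<Longrightarrow> closed (epi (fenchel_conj f))"
  by (auto simp: epi_fenchel_conj intro!: closed_halfspace_le)

lemma convex_epi_fenchel_conj: "proper_fun f \<Longrightarrow> convex (epi (fenchel_conj f))"
  by (auto simp: epi_fenchel_conj intro!: convex_INT convex_halfspace_le)

lemma epi_nonempty: "proper_fun f \<Longrightarrow> epi f \<noteq> {}"
  using proper_fun_finite_point by (metis empty_iff mem_epi order_refl)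

section \<open>Separation and the Fenchel-Moreau theorem\<close>

text \<open>Here \<open>(p, r)\<close> is the projection of \<open>(e, \<xi>)\<close> onto the
  epigraph, and the residual is normal to a supporting hyperplane. The case \<open>r = \<xi>\<close>
  is that of a vertical hyperplane.\<close>

lemma epi_separation:
  assumes f: "f \<in> Gamma0" and above: "ereal \<xi> < f e"
  obtains p r where "f p \<le> ereal r" "\<xi> \<le> r" "(e, \<xi>) \<noteq> (p, r)"
    "\<And>y s. f y \<le> ereal s \<Longrightarrow> inner (e - p) (y - p) \<le> (r - \<xi>) * (s - r)"
proof -
  define p r where "p = fst (proj_onto (epi f) (e, \<xi>))" and "r = snd (proj_onto (epi f) (e, \<xi>))"
  have proj: "proj_onto (epi f) (e, \<xi>) = (p, r)" by (simp add: p_def r_def)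
  have E: "closed (epi f)" "convex (epi f)" "epi f \<noteq> {}"
    using f by (auto simp: Gamma0_def closed_epi convex_epi epi_nonempty)
  from closed_convex_proj(1)[OF E, of "(e, \<xi>)"] have pr: "f p \<le> ereal r"
    by (simp add: proj)
  have le: "inner (e - p) (y - p) \<le> (r - \<xi>) * (s - r)" if "f y \<le> ereal s" for y s
    using closed_convex_proj(2)[OF E, of "(y, s)" "(e, \<xi>)"] that
    by (simp add: proj algebra_simps)
  \<comment> \<open>Testing one unit above \<open>(p, r)\<close>, still in the epigraph, fixes the
    sign of \<open>r - \<xi>\<close>.\<close>
  have "f p \<le> ereal (r + 1)" using pr by (rule order_trans) simp
  from le[OF this] have "\<xi> \<le> r" by simp
  moreover have "(e, \<xi>) \<noteq> (p, r)" using pr above by auto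
  ultimately show ?thesis using that pr le by blast
qed

text \<open>A nonvertical hyperplane with normal \<open>(a, - b)\<close>, rescaled to last
  coordinate \<open>- 1\<close>, is the graph of an affine minorant of slope
  \<open>a /\<^sub>R b\<close>.\<close>

lemma fenchel_conj_le_of_slope:
  assumes "proper_fun f" "0 < b"
    and le: "\<And>y s. f y \<le> ereal s \<Longrightarrow> inner a (y - p) \<le> b * (s - r)"
  shows "fenchel_conj f (a /\<^sub>R b) \<le> ereal (inner p (a /\<^sub>R b) - r)"
  unfolding fenchel_conj_le_iff[OF assms(1)]
proof (intro allI impI)
  fix y s assume "f y \<le> ereal s"
  from le[OF this] \<open>0 < b\<close> have "(inner y a - inner p a) / b \<le> s - r"
    by (simp add: pos_divide_le_eq inner_diff_right inner_commute mult.commute)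
  then show "inner y (a /\<^sub>R b) - s \<le> inner p (a /\<^sub>R b) - r"
    by (simp add: divide_inverse algebra_simps)
qed

text \<open>A hyperplane separating a point strictly below the graph, over a point of the domain,
  cannot be vertical; it therefore yields an affine minorant.\<close>

lemma Gamma0_fenchel_conj_finite:
  assumes "f \<in> Gamma0"
  obtains u s where "fenchel_conj f u \<le> ereal s"
proof -
  have proper: "proper_fun f" using assms by (simp add: Gamma0_def)
  obtain e r0 where e: "f e = ereal r0" using proper by (rule proper_fun_finite_point)
  then have "ereal (r0 - 1) < f e" by simp
  with assms obtain p r where pr: "f p \<le> ereal r" "r0 - 1 \<le> r" "(e, r0 - 1) \<noteq> (p, r)"
    and le: "\<And>y s. f y \<le> ereal s \<Longrightarrow> inner (e - p) (y - p) \<le> (r - (r0 - 1)) * (s - r)"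
    by (rule epi_separation) blast
  have "r \<noteq> r0 - 1"
  proof
    assume "r = r0 - 1"
    with le[of e r0] e have "inner (e - p) (e - p) \<le> 0" by simp
    then have "e - p = 0" by (metis inner_ge_zero inner_eq_zero_iff antisym)
    with pr(3) \<open>r = r0 - 1\<close> show False by simp
  qed
  with pr(2) have "0 < r - (r0 - 1)" by simp
  from fenchel_conj_le_of_slope[OF proper this le] that show ?thesis by blast
qed

text \<open>
  When the hyperplane separating \<open>(e, M)\<close> from the epigraph is vertical, adding large multiples of its normal to a fixed affine minorant gives
  minorants that are unbounded at \<open>e\<close>.
\<close>

lemma fenchel_moreau:
  assumes f: "f \<in> Gamma0"
    and le_M: "\<And>u s. fenchel_conj f u \<le> ereal s \<Longrightarrow> inner e u - s \<le> M"
  shows "f e \<le> ereal M"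
proof (rule ccontr)
  assume "\<not> f e \<le> ereal M"
  then have "ereal M < f e" by simp
  with f obtain p r where pr: "f p \<le> ereal r" "M \<le> r" "(e, M) \<noteq> (p, r)"
    and le: "\<And>y s. f y \<le> ereal s \<Longrightarrow> inner (e - p) (y - p) \<le> (r - M) * (s - r)"
    by (rule epi_separation) blast
  have proper: "proper_fun f" using f by (simp add: Gamma0_def)
  show False
  proof (cases "r = M")
    case False
    with pr(2) have pos: "0 < r - M" by simp
    \<comment> \<open>At \<open>e\<close> the minorant takes the value \<open>r\<close> plus a
      nonnegative term, while \<open>M < r\<close>.\<close>
    from le_M[OF fenchel_conj_le_of_slope[OF proper this le]]
    have "inner (e - p) ((e - p) /\<^sub>R (r - M)) + r \<le> M"
      by (simp add: inner_diff_left inner_diff_right algebra_simps)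
    moreover have "0 \<le> inner (e - p) ((e - p) /\<^sub>R (r - M))"
      using pos by simp
    ultimately show False using pos by linarith
  next
    case True
    with pr(3) have "e - p \<noteq> 0" by auto
    then have pos: "0 < inner (e - p) (e - p)" by simp
    obtain u0 s0 where u0: "fenchel_conj f u0 \<le> ereal s0"
      using f by (rule Gamma0_fenchel_conj_finite)
    \<comment> \<open>This \<open>k\<close> lifts the minorant of slope \<open>u0\<close> at
      \<open>e\<close> to at least one above \<open>M\<close>.\<close>
    define k where "k = (\<bar>M - inner e u0 + s0\<bar> + 1) / inner (e - p) (e - p)"
    have "0 \<le> k" using pos by (simp add: k_def)
    have "fenchel_conj f (u0 + k *\<^sub>R (e - p)) \<le> ereal (s0 + k * inner (e - p) p)"
      unfolding fenchel_conj_le_iff[OF proper]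
    proof (intro allI impI)
      fix y s assume ys: "f y \<le> ereal s"
      have "k * inner (e - p) (y - p) \<le> 0"
        using le[OF ys] True \<open>0 \<le> k\<close> by (simp add: mult_nonneg_nonpos)
      moreover have "inner y u0 \<le> s + s0" using fenchel_young[OF proper ys u0] .
      ultimately show "inner y (u0 + k *\<^sub>R (e - p)) - s \<le> s0 + k * inner (e - p) p"
        by (simp add: inner_add_right inner_diff_left inner_diff_right inner_commute algebra_simps)
    qed
    from le_M[OF this] have "inner e u0 - s0 + k * inner (e - p) (e - p) \<le> M"
      by (simp add: inner_add_right inner_diff_left inner_diff_right inner_commute algebra_simps)
    moreover have "k * inner (e - p) (e - p) = \<bar>M - inner e u0 + s0\<bar> + 1"
      using pos by (simp add: k_def)
    ultimately show False by linarith
  qed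
qed

section \<open>Recession function and perspective as support functions\<close>

text \<open>For every base point the difference quotient is at most the support value for all
  \<open>t > 0\<close>, by Fenchel-Moreau, and at least \<open>inner y u\<close> up to a multiple of
  \<open>1 / t\<close> for each \<open>u\<close> in the domain of the conjugate. Hence all the
  limits exist and agree.\<close>

lemma rec_fun_eq_support:
  assumes f: "f \<in> Gamma0"
  shows "rec_fun f y = (SUP u\<in>edom (fenchel_conj f). ereal (inner y u))" (is "_ = ?\<sigma>")
proof -
  have proper: "proper_fun f" using f by (simp add: Gamma0_def)
  have lim: "((\<lambda>t::real. (f (x0 + t *\<^sub>R y) - f x0) / ereal t) \<longlongrightarrow> ?\<sigma>) at_top"
    if x0: "x0 \<in> edom f" for x0
  proof -
    obtain r0 where r0: "f x0 = ereal r0"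
      using x0 proper by (cases "f x0") (auto simp: edom_def proper_fun_def)
    have upper: "(f (x0 + t *\<^sub>R y) - f x0) / ereal t \<le> ?\<sigma>" if "0 < t" for t
    proof (cases "?\<sigma>")
      case (real M)
      have "f (x0 + t *\<^sub>R y) \<le> ereal (r0 + t * M)"
      proof (rule fenchel_moreau[OF f])
        fix u s assume us: "fenchel_conj f u \<le> ereal s"
        then have "u \<in> edom (fenchel_conj f)" unfolding edom_def
          by (metis PInfty_neq_ereal(1) ereal_infty_less_eq(1) mem_Collect_eq not_less order_trans)
        then have "ereal (inner y u) \<le> ?\<sigma>" by (rule SUP_upper)
        then have "inner y u \<le> M" unfolding real by simp
        then have "t * inner y u \<le> t * M" using that by simp
        moreover have "inner x0 u \<le> r0 + s" using fenchel_young[OF proper _ us] r0 by simp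
        ultimately show "inner (x0 + t *\<^sub>R y) u - s \<le> r0 + t * M"
          by (simp add: inner_add_left)
      qed
      then show ?thesis
        unfolding real r0 using that
        by (cases "f (x0 + t *\<^sub>R y)") (auto simp: field_simps)
    next
      case MInf
      obtain u s where "fenchel_conj f u \<le> ereal s" using f by (rule Gamma0_fenchel_conj_finite)
      then have "u \<in> edom (fenchel_conj f)" unfolding edom_def
        by (metis PInfty_neq_ereal(1) ereal_infty_less_eq(1) mem_Collect_eq not_less order_trans)
      then have "ereal (inner y u) \<le> ?\<sigma>" by (rule SUP_upper)
      then show ?thesis unfolding MInf by simp
    qed simp
    show ?thesis
    proof (rule order_tendstoI)
      fix a assume "a < ?\<sigma>"
      then obtain u where u: "u \<in> edom (fenchel_conj f)" "a < ereal (inner y u)"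
        unfolding less_SUP_iff by blast
      obtain s where s: "fenchel_conj f u = ereal s"
        using u(1) fenchel_conj_not_MInf[OF proper]
        by (cases "fenchel_conj f u") (auto simp: edom_def)
      \<comment> \<open>Fenchel-Young at \<open>x0 + t *\<^sub>R y\<close>, divided by
        \<open>t\<close>, bounds the quotient below by this expression.\<close>
      have "((\<lambda>t. inner y u + (inner x0 u - s - r0) / t) \<longlongrightarrow> inner y u + 0) at_top"
        by (intro tendsto_intros real_tendsto_divide_at_top[OF tendsto_const] filterlim_ident)
      then have "((\<lambda>t. ereal (inner y u + (inner x0 u - s - r0) / t)) \<longlongrightarrow> ereal (inner y u)) at_top"
        by simp
      from order_tendstoD(1)[OF this u(2)] eventually_gt_at_top[of 0]
      show "\<forall>\<^sub>F t in at_top. a < (f (x0 + t *\<^sub>R y) - f x0) / ereal t"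
      proof eventually_elim
        case (elim t)
        have "ereal (inner y u + (inner x0 u - s - r0) / t) \<le> (f (x0 + t *\<^sub>R y) - f x0) / ereal t"
        proof (cases "f (x0 + t *\<^sub>R y)")
          case (real v)
          from fenchel_young[OF proper, of "x0 + t *\<^sub>R y" v u s] s real
          have "inner x0 u + t * inner y u \<le> v + s" by (simp add: inner_add_left)
          then have "(t * inner y u + (inner x0 u - s - r0)) / t \<le> (v - r0) / t"
            using \<open>0 < t\<close> by (intro divide_right_mono) auto
          then show ?thesis using \<open>0 < t\<close> by (simp add: real r0 add_divide_distrib)
        next
          case PInf
          then show ?thesis using \<open>0 < t\<close> by (simp add: r0)
        next
          case MInf
          then show ?thesis using proper by (simp add: proper_fun_def)
        qed
        with elim(1) show ?case by (rule less_le_trans)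
      qed
    next
      fix a assume "?\<sigma> < a"
      then show "\<forall>\<^sub>F t in at_top. (f (x0 + t *\<^sub>R y) - f x0) / ereal t < a"
        using upper by (intro eventually_mono[OF eventually_gt_at_top[of 0]]) (rule le_less_trans)
    qed
  qed
  obtain x0 where x0: "x0 \<in> edom f" using proper by (auto simp: proper_fun_def)
  show ?thesis unfolding rec_fun_def
  proof (rule the_equality)
    fix r assume "\<forall>x0\<in>edom f. ((\<lambda>t::real. (f (x0 + t *\<^sub>R y) - f x0) / ereal t) \<longlongrightarrow> r) at_top"
    then show "r = ?\<sigma>"
      using tendsto_unique[OF _ _ lim[OF x0]] x0 by (metis trivial_limit_at_top_linorder)
  qed (use lim in blast)
qed

text \<open>For positive \<open>s\<close> this is Fenchel-Young at \<open>y /\<^sub>R s\<close>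
  multiplied by \<open>s\<close>; at \<open>s = 0\<close> it is the support formula for the
  recession function.\<close>

lemma perspective_ge:
  assumes f: "f \<in> Gamma0" and u: "fenchel_conj f u \<le> ereal (- \<nu>)"
  shows "ereal (inner (y, s) (u, \<nu>)) \<le> perspective f (y, s)"
proof -
  have proper: "proper_fun f" using f by (simp add: Gamma0_def)
  consider "s > 0" | "s = 0" | "s < 0" by linarith
  then show ?thesis
  proof cases
    case 1
    show ?thesis
    proof (cases "f (y /\<^sub>R s)")
      case (real v)
      from fenchel_young[OF proper, of "y /\<^sub>R s" v u "- \<nu>"] u real
      have "inner y u + s * \<nu> \<le> s * v" using 1 by (simp add: field_simps)
      then show ?thesis using 1 real by (simp add: perspective_def)
    next
      case MInf
      then show ?thesis using proper by (simp add: proper_fun_def)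
    qed (use 1 in \<open>simp add: perspective_def\<close>)
  next
    case 2
    have "u \<in> edom (fenchel_conj f)"
      using u by (auto simp: edom_def intro: le_less_trans)
    then have "ereal (inner y u) \<le> rec_fun f y"
      unfolding rec_fun_eq_support[OF f] by (rule SUP_upper)
    then show ?thesis using 2 by (simp add: perspective_def)
  qed (simp add: perspective_def)
qed

section \<open>Subgradient criteria for the proximity operators\<close>

text \<open>Moreau's decomposition: \<open>le\<close> makes the linear minorant given by
  \<open>(u, \<nu>)\<close> exact at \<open>p\<close>, so \<open>(u, \<nu>)\<close> is a subgradient
  there, and \<open>z - p\<close> is \<open>\<gamma>\<close> times it.\<close>

lemma prox_perspectiveI:
  assumes f: "f \<in> Gamma0" and "0 < \<gamma>" and w: "fenchel_conj f u \<le> ereal (- \<nu>)"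
    and p: "p = z - \<gamma> *\<^sub>R (u, \<nu>)"
    and le: "perspective f p \<le> ereal (inner p (u, \<nu>))"
  shows "prox (\<lambda>z. ereal \<gamma> * perspective f z) z = p"
proof (rule proxI)
  have eq: "perspective f p = ereal (inner p (u, \<nu>))"
    using le perspective_ge[OF f w, of "fst p" "snd p"] by simp
  then show "ereal \<gamma> * perspective f p = ereal (\<gamma> * inner p (u, \<nu>))" by simp
  fix y
  have "\<gamma> * inner p (u, \<nu>) + inner (z - p) (y - p) = \<gamma> * inner y (u, \<nu>)"
    unfolding p by (simp add: inner_diff_right inner_commute algebra_simps del: scaleR_Pair)
  moreover have "ereal \<gamma> * ereal (inner y (u, \<nu>)) \<le> ereal \<gamma> * perspective f y"
    using perspective_ge[OF f w, of "fst y" "snd y"] \<open>0 < \<gamma>\<close>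
    by (intro ereal_mult_left_mono) auto
  ultimately show "ereal (\<gamma> * inner p (u, \<nu>) + inner (z - p) (y - p)) \<le> ereal \<gamma> * perspective f y"
    by simp
qed

lemma prox_scaleI:
  assumes "0 < l" and q: "g q = ereal c"
    and le: "\<And>v s. g v \<le> ereal s \<Longrightarrow> c + inner ((x - q) /\<^sub>R l) (v - q) \<le> s"
  shows "prox (\<lambda>u. ereal l * g u) x = q"
proof (rule proxI)
  show "ereal l * g q = ereal (l * c)" by (simp add: q)
  fix v
  show "ereal (l * c + inner (x - q) (v - q)) \<le> ereal l * g v"
  proof (cases "g v")
    case (real s)
    with le[of v s] have "c + inner (x - q) (v - q) / l \<le> s" by (simp add: divide_inverse_commute)
    with real \<open>0 < l\<close> show ?thesis by (simp add: field_simps)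
  next
    \<comment> \<open>Minus infinity is ruled out by an \<open>s\<close> one below the lower bound
      that \<open>le\<close> imposes.\<close>
    case MInf
    with le[of v "c + inner ((x - q) /\<^sub>R l) (v - q) - 1"] show ?thesis by simp
  qed (use \<open>0 < l\<close> in simp)
qed

text \<open>Since \<open>prox\<close> is a definite description, a minimizer must be produced before
  anything is known about \<open>q\<close>; minimization over an epigraph supplies it with its
  subgradient inequality.\<close>

lemma prox_scaled_fenchel_conj:
  fixes x :: "'a::{real_inner,complete_space}"
  assumes f: "f \<in> Gamma0" and "0 < l"
  defines "q \<equiv> prox (\<lambda>u. ereal l * fenchel_conj f u) x"
  obtains c where "fenchel_conj f q = ereal c"
    "\<And>v s. fenchel_conj f v \<le> ereal s \<Longrightarrow> c + inner ((x - q) /\<^sub>R l) (v - q) \<le> s"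
proof -
  let ?g = "fenchel_conj f"
  have proper: "proper_fun f" using f by (simp add: Gamma0_def)
  obtain y0 r0 where y0: "f y0 = ereal r0" using proper by (rule proper_fun_finite_point)
  \<comment> \<open>The preimage under \<open>T\<close> of the epigraph of the conjugate is the
    epigraph of its \<open>l\<close>-fold multiple.\<close>
  define T where "T z = (fst z, snd z / l)" for z :: "'a \<times> real"
  have T: "linear T" "continuous_on UNIV T"
    unfolding T_def using \<open>0 < l\<close>
    by (auto intro!: linearI continuous_intros simp: add_divide_distrib)
  obtain p r where pr: "(p, r) \<in> T -` epi ?g"
    and le: "\<And>y s. (y, s) \<in> T -` epi ?g \<Longrightarrow> r + inner (x - p) (y - p) \<le> s"
  proof (rule closed_convex_prox_exists[of "T -` epi ?g" "l *\<^sub>R y0" "- l * r0" x])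
    show "closed (T -` epi ?g)"
      using T(2) closed_epi_fenchel_conj[OF proper] by (simp add: closed_vimage continuous_on_eq_continuous_at)
    show "convex (T -` epi ?g)"
      using T(1) convex_epi_fenchel_conj[OF proper] by (rule convex_linear_vimage)
    obtain u s where "?g u \<le> ereal s" using f by (rule Gamma0_fenchel_conj_finite)
    then have "(u, l * s) \<in> T -` epi ?g" using \<open>0 < l\<close> by (simp add: T_def)
    then show "T -` epi ?g \<noteq> {}" by blast
    fix y s assume "(y, s) \<in> T -` epi ?g"
    then have "inner y0 y \<le> r0 + s / l"
      using fenchel_young[OF proper, of y0 r0 y "s / l"] y0 by (simp add: T_def)
    then show "inner (l *\<^sub>R y0) y + - l * r0 \<le> s" using \<open>0 < l\<close> by (simp add: field_simps)
  qed blast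
  have le': "r / l + inner ((x - p) /\<^sub>R l) (v - p) \<le> s" if "?g v \<le> ereal s" for v s
  proof -
    have "r + inner (x - p) (v - p) \<le> l * s"
      using le[of v "l * s"] that \<open>0 < l\<close> by (simp add: T_def)
    then have "r / l + inner (x - p) (v - p) / l \<le> s" using \<open>0 < l\<close> by (simp add: field_simps)
    then show ?thesis by (simp add: divide_inverse_commute)
  qed
  \<comment> \<open>Membership gives only \<open>\<le>\<close>; the inequality \<open>le'\<close> at
    \<open>v = p\<close> gives the converse.\<close>
  have "?g p = ereal (r / l)"
  proof (cases "?g p")
    case (real s)
    then show ?thesis using pr le'[of p s] by (simp add: T_def)
  next
    case MInf
    then show ?thesis using fenchel_conj_not_MInf[OF proper] by blast
  qed (use pr in \<open>simp add: T_def\<close>)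
  moreover from this have "q = p"
    unfolding q_def using \<open>0 < l\<close> le' by (intro prox_scaleI[where c="r / l"])
  ultimately show ?thesis using that le' by blast
qed

section \<open>The two cases of the formula\<close>

theorem theorem3p1:
  fixes f :: "'a::{real_inner,complete_space} \<Rightarrow> ereal"
    and \<gamma> \<eta> :: real
    and x :: 'a
  assumes "f \<in> Gamma0"
    and "0 < \<gamma>"
  shows "let P = proj_onto (closure (edom (fenchel_conj f)));
             b = ereal \<eta> + ereal \<gamma> * fenchel_conj f (P (x /\<^sub>R \<gamma>));
             p = (\<lambda>\<mu>::real. prox (\<lambda>u. ereal (\<mu> / \<gamma>) * fenchel_conj f u) (x /\<^sub>R \<gamma>));
             Q = (\<lambda>\<mu>::real. 0 < \<mu> \<and> ereal \<mu> \<le> b \<and>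
                    ereal \<mu> = ereal \<eta> + ereal \<gamma> * fenchel_conj f (p \<mu>))
         in (b \<le> 0 \<longrightarrow>
               prox (\<lambda>z. ereal \<gamma> * perspective f z) (x, \<eta>) = (x - \<gamma> *\<^sub>R P (x /\<^sub>R \<gamma>), 0)) \<and>
            (b > 0 \<longrightarrow>
               (\<exists>!\<mu>. Q \<mu>) \<and>
               (\<forall>\<mu>. Q \<mu> \<longrightarrow>
                  prox (\<lambda>z. ereal \<gamma> * perspective f z) (x, \<eta>) = (x - \<gamma> *\<^sub>R p \<mu>, \<mu>)))"
proof -
  let ?g = "fenchel_conj f"
  define D where "D = closure (edom ?g)"
  define P where "P = proj_onto D (x /\<^sub>R \<gamma>)"
  define b where "b = ereal \<eta> + ereal \<gamma> * ?g P"
  define p where "p \<mu> = prox (\<lambda>u. ereal (\<mu> / \<gamma>) * ?g u) (x /\<^sub>R \<gamma>)" for \<mu>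
  define Q where "Q \<mu> \<longleftrightarrow> 0 < \<mu> \<and> ereal \<mu> \<le> b \<and> ereal \<mu> = ereal \<eta> + ereal \<gamma> * ?g (p \<mu>)" for \<mu>
  have proper: "proper_fun f" using assms(1) by (simp add: Gamma0_def)
  have edom_iff: "u \<in> edom ?g \<longleftrightarrow> (\<exists>s. ?g u \<le> ereal s)" for u
    using fenchel_conj_not_MInf[OF proper, of u] by (cases "?g u") (auto simp: edom_def)
  have edom_eq: "edom ?g = fst ` epi ?g"
    by (auto simp: edom_iff image_iff Bex_def)
  have D: "closed D" "convex D" "D \<noteq> {}"
  proof -
    show "convex D"
      unfolding D_def edom_eq
      by (intro convex_closure convex_linear_image linear_fst convex_epi_fenchel_conj proper)
    obtain u s where "?g u \<le> ereal s" using assms(1) by (rule Gamma0_fenchel_conj_finite)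
    then show "D \<noteq> {}" using edom_iff[of u] by (auto simp: D_def)
  qed (simp add: D_def)
  have P_le: "inner (x /\<^sub>R \<gamma> - P) (v - P) \<le> 0" if "v \<in> edom ?g" for v
    using closed_convex_proj(2)[OF D] that closure_subset by (auto simp: P_def D_def)
  \<comment> \<open>The dual point is \<open>(P, \<eta> / \<gamma>)\<close>:
    \<open>b \<le> 0\<close> places it in the supported set, and the residual is horizontal.\<close>
  have case1: "prox (\<lambda>z. ereal \<gamma> * perspective f z) (x, \<eta>) = (x - \<gamma> *\<^sub>R P, 0)" if "b \<le> 0"
  proof (rule prox_perspectiveI[OF assms, of P "\<eta> / \<gamma>"])
    show "?g P \<le> ereal (- (\<eta> / \<gamma>))"
      using that fenchel_conj_not_MInf[OF proper, of P] assms(2)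
      by (cases "?g P") (auto simp: b_def field_simps)
    show "(x - \<gamma> *\<^sub>R P, 0) = (x, \<eta>) - \<gamma> *\<^sub>R (P, \<eta> / \<gamma>)" using assms(2) by simp
    \<comment> \<open>At height 0 the perspective is the support function of \<open>edom ?g\<close>,
      which the projection inequality bounds by the value at \<open>P\<close>.\<close>
    have "inner (x - \<gamma> *\<^sub>R P) v \<le> inner (x - \<gamma> *\<^sub>R P) P" if "v \<in> edom ?g" for v
    proof -
      have "x - \<gamma> *\<^sub>R P = \<gamma> *\<^sub>R (x /\<^sub>R \<gamma> - P)"
        using assms(2) by (simp add: algebra_simps)
      then have "inner (x - \<gamma> *\<^sub>R P) (v - P) \<le> 0"
        using P_le[OF that] assms(2) by (simp add: mult_nonneg_nonpos)
      then show ?thesis by (simp add: inner_diff_right)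
    qed
    then show "perspective f (x - \<gamma> *\<^sub>R P, 0) \<le> ereal (inner (x - \<gamma> *\<^sub>R P, 0) (P, \<eta> / \<gamma>))"
      by (auto simp: perspective_def rec_fun_eq_support[OF assms(1)] intro!: SUP_least)
  qed
  have case2: "prox (\<lambda>z. ereal \<gamma> * perspective f z) (x, \<eta>) = (x - \<gamma> *\<^sub>R p \<mu>, \<mu>)" if "Q \<mu>" for \<mu>
  proof -
    from that have \<mu>: "0 < \<mu>" and eq: "ereal \<mu> = ereal \<eta> + ereal \<gamma> * ?g (p \<mu>)"
      by (auto simp: Q_def)
    obtain c where c: "?g (p \<mu>) = ereal c"
      and le: "\<And>v s. ?g v \<le> ereal s \<Longrightarrow> c + inner ((x /\<^sub>R \<gamma> - p \<mu>) /\<^sub>R (\<mu> / \<gamma>)) (v - p \<mu>) \<le> s"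
      unfolding p_def
      using prox_scaled_fenchel_conj[OF assms(1) divide_pos_pos[OF \<mu> assms(2)]] by blast
    have \<mu>_eq: "\<mu> = \<eta> + \<gamma> * c" using eq c by simp
    \<comment> \<open>\<open>d\<close> is a subgradient of the conjugate at \<open>p \<mu>\<close>.
      Fenchel-Moreau converts this into a bound on \<open>f d\<close>, and multiplication by
      \<open>\<mu>\<close> gives the bound on the perspective.\<close>
    define d where "d = (x - \<gamma> *\<^sub>R p \<mu>) /\<^sub>R \<mu>"
    have d_eq: "(x /\<^sub>R \<gamma> - p \<mu>) /\<^sub>R (\<mu> / \<gamma>) = d"
    proof -
      have "x - \<gamma> *\<^sub>R p \<mu> = \<gamma> *\<^sub>R (x /\<^sub>R \<gamma> - p \<mu>)"
        using assms(2) by (simp add: algebra_simps)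
      then show ?thesis by (simp add: d_def divide_inverse_commute)
    qed
    have "f d \<le> ereal (inner d (p \<mu>) - c)"
    proof (rule fenchel_moreau[OF assms(1)])
      fix v s assume "?g v \<le> ereal s"
      from le[OF this] show "inner d v - s \<le> inner d (p \<mu>) - c"
        unfolding d_eq by (simp add: inner_diff_right)
    qed
    then have "ereal \<mu> * f d \<le> ereal \<mu> * ereal (inner d (p \<mu>) - c)"
      using \<mu> by (intro ereal_mult_left_mono) auto
    also have "\<dots> = ereal (inner (x - \<gamma> *\<^sub>R p \<mu>, \<mu>) (p \<mu>, - c))"
      using \<mu> by (simp add: d_def right_diff_distrib)
    finally have "perspective f (x - \<gamma> *\<^sub>R p \<mu>, \<mu>) \<le> ereal (inner (x - \<gamma> *\<^sub>R p \<mu>, \<mu>) (p \<mu>, - c))"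
      using \<mu> by (simp add: perspective_def d_def)
    then show ?thesis
      using c \<mu>_eq by (intro prox_perspectiveI[OF assms, of "p \<mu>" "- c"]) auto
  qed
  have existence: "\<exists>\<mu>. Q \<mu>" if "b > 0"
  proof -
    \<comment> \<open>The reflected epigraph is the set supported by the perspective;
      \<open>\<mu>\<close> is read off from a projection onto it.\<close>
    define C where "C = (\<lambda>z. (fst z, - snd z)) -` epi ?g"
    have C: "closed C" "convex C" "C \<noteq> {}"
    proof -
      show "closed C" unfolding C_def
        by (intro closed_vimage closed_epi_fenchel_conj proper continuous_intros)
      have "linear (\<lambda>z::'a \<times> real. (fst z, - snd z))" by (auto intro!: linearI)
      then show "convex C" unfolding C_def
        using convex_epi_fenchel_conj[OF proper] by (rule convex_linear_vimage)
      obtain u s where "?g u \<le> ereal s" using assms(1) by (rule Gamma0_fenchel_conj_finite)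
      then have "(u, - s) \<in> C" by (simp add: C_def)
      then show "C \<noteq> {}" by blast
    qed
    obtain q \<nu> where proj: "proj_onto C (x /\<^sub>R \<gamma>, \<eta> / \<gamma>) = (q, \<nu>)" by (rule prod.exhaust)
    from closed_convex_proj(1)[OF C, of "(x /\<^sub>R \<gamma>, \<eta> / \<gamma>)"]
    have "(q, \<nu>) \<in> C" by (simp add: proj)
    then have q_le: "?g q \<le> ereal (- \<nu>)" by (simp add: C_def)
    then obtain c where c: "?g q = ereal c"
      using fenchel_conj_not_MInf[OF proper, of q] by (cases "?g q") auto
    with q_le have c_le: "c \<le> - \<nu>" by simp
    \<comment> \<open>\<open>\<gamma>\<close> times the last coordinate of the projection
      residual.\<close>
    define \<mu> where "\<mu> = \<eta> - \<gamma> * \<nu>"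
    have le: "inner (x /\<^sub>R \<gamma> - q) (v - q) \<le> \<mu> / \<gamma> * (s + \<nu>)" if "?g v \<le> ereal s" for v s
    proof -
      have "(v, - s) \<in> C" using that by (simp add: C_def)
      from closed_convex_proj(2)[OF C this, of "(x /\<^sub>R \<gamma>, \<eta> / \<gamma>)"]
      have "inner (x /\<^sub>R \<gamma> - q) (v - q) \<le> (\<eta> / \<gamma> - \<nu>) * (s + \<nu>)"
        by (simp add: proj algebra_simps add_divide_distrib)
      also have "\<eta> / \<gamma> - \<nu> = \<mu> / \<gamma>" using assms(2) by (simp add: \<mu>_def field_simps)
      finally show ?thesis .
    qed
    have q_dom: "q \<in> edom ?g" using q_le edom_iff by blast
    have "?g q \<le> ereal (- \<nu> + 1)" using c_le c by simp
    from le[OF this] have "0 \<le> \<mu>" using assms(2) by (simp add: zero_le_divide_iff)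
    \<comment> \<open>A horizontal residual would make \<open>q\<close> the projection onto
      \<open>D\<close>, so \<open>q = P\<close>, and membership in \<open>C\<close> would contradict
      \<open>b > 0\<close>.\<close>
    moreover have "\<mu> \<noteq> 0"
    proof
      assume "\<mu> = 0"
      have "inner (x /\<^sub>R \<gamma> - q) (v - q) \<le> 0" if "v \<in> edom ?g" for v
        using that le \<open>\<mu> = 0\<close> by (auto simp: edom_iff)
      then have "edom ?g \<subseteq> {v. inner (x /\<^sub>R \<gamma> - q) v \<le> inner (x /\<^sub>R \<gamma> - q) q}"
        by (auto simp: inner_diff_right)
      then have "D \<subseteq> {v. inner (x /\<^sub>R \<gamma> - q) v \<le> inner (x /\<^sub>R \<gamma> - q) q}"
        unfolding D_def by (intro closure_minimal closed_halfspace_le)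
      moreover have "q \<in> D" using q_dom closure_subset by (auto simp: D_def)
      ultimately have "P = q"
        unfolding P_def by (intro proj_ontoI) (auto simp: inner_diff_right)
      moreover have "\<eta> + \<gamma> * c \<le> 0"
        using mult_left_mono[OF c_le, of \<gamma>] assms(2) \<open>\<mu> = 0\<close> by (simp add: \<mu>_def)
      ultimately show False using that c by (simp add: b_def)
    qed
    ultimately have \<mu>: "0 < \<mu>" by simp
    then have ratio: "0 < \<mu> / \<gamma>" using assms(2) by simp
    \<comment> \<open>Complementary slackness: positivity of \<open>\<mu>\<close> forces equality in
      \<open>c \<le> - \<nu>\<close>.\<close>
    have "0 \<le> \<mu> / \<gamma> * (c + \<nu>)" using le[of q c] c by simp
    then have "0 \<le> c + \<nu>" using \<mu> assms(2) by (simp add: zero_le_mult_iff zero_le_divide_iff)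
    with c_le have c_eq: "c = - \<nu>" by simp
    \<comment> \<open>Division of the normal cone inequality by \<open>\<mu> / \<gamma>\<close>
      yields the subgradient condition for \<open>prox\<close>.\<close>
    have "p \<mu> = q" unfolding p_def
    proof (rule prox_scaleI[where c=c])
      fix v s assume "?g v \<le> ereal s"
      from le[OF this] have "inner (x /\<^sub>R \<gamma> - q) (v - q) / (\<mu> / \<gamma>) \<le> s + \<nu>"
        unfolding pos_divide_le_eq[OF ratio] by (simp only: mult.commute)
      then show "c + inner ((x /\<^sub>R \<gamma> - q) /\<^sub>R (\<mu> / \<gamma>)) (v - q) \<le> s"
        by (simp add: c_eq divide_inverse mult.commute mult.left_commute)
    qed (fact ratio c)+
    have \<mu>_eq: "\<mu> = \<eta> + \<gamma> * c" by (simp add: \<mu>_def c_eq)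
    have "ereal \<mu> \<le> b"
    proof (cases "?g P")
      case (real s)
      \<comment> \<open>The projection inequality at \<open>q\<close> makes this inner product
        nonnegative, and \<open>le\<close> then compares the conjugate at \<open>q\<close> and at
        \<open>P\<close>.\<close>
      have "inner (x /\<^sub>R \<gamma> - q) (P - q)
          = inner (P - q) (P - q) - inner (x /\<^sub>R \<gamma> - P) (q - P)"
        by (simp add: inner_diff_left inner_diff_right inner_commute algebra_simps)
      then have "0 \<le> inner (x /\<^sub>R \<gamma> - q) (P - q)"
        using P_le[OF q_dom] inner_ge_zero[of "P - q"] by linarith
      also have "\<dots> \<le> \<mu> / \<gamma> * (s - c)" using le[of P s] real by (simp add: c_eq)
      finally have "c \<le> s" using \<mu> assms(2) by (simp add: zero_le_mult_iff zero_le_divide_iff)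
      then show ?thesis using assms(2) by (simp add: b_def real \<mu>_eq)
    next
      case PInf
      then show ?thesis using assms(2) by (simp add: b_def)
    qed (use fenchel_conj_not_MInf[OF proper] in blast)
    then have "Q \<mu>" using \<mu> c \<mu>_eq \<open>p \<mu> = q\<close> by (simp add: Q_def)
    then show ?thesis by blast
  qed
  \<comment> \<open>Both values are the last coordinate of the same point.\<close>
  have unique: "\<mu> = \<mu>'" if "Q \<mu>" "Q \<mu>'" for \<mu> \<mu>'
    using case2[OF that(1)] case2[OF that(2)] by simp
  have "(b \<le> 0 \<longrightarrow> prox (\<lambda>z. ereal \<gamma> * perspective f z) (x, \<eta>) = (x - \<gamma> *\<^sub>R P, 0)) \<and>
    (b > 0 \<longrightarrow> (\<exists>!\<mu>. Q \<mu>) \<and>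
       (\<forall>\<mu>. Q \<mu> \<longrightarrow> prox (\<lambda>z. ereal \<gamma> * perspective f z) (x, \<eta>) = (x - \<gamma> *\<^sub>R p \<mu>, \<mu>)))"
    using case1 case2 existence unique by blast
  then show ?thesis
    unfolding Let_def Q_def p_def b_def P_def D_def .
qed

end
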